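(* Let $\tau>0$ and $\mathbf{X}^0\in[V^h]^2$. Let $\mathbf{X}^1\in[V^h]^2$ be obtained from $\mathbf{X}^0$ by one step of the SP-Euler scheme with time step $\tau$ (see context), and for each $m\ge1$ let $(\mathbf{X}^{m+1},\kappa^{m+1},\lambda^{m+1},\eta^{m+1})\in[V^h]^2\times V^h\times\mathbb{R}\times\mathbb{R}$ be a solution of the SP-BDF2 scheme: for all $(\varphi^h,\boldsymbol{\omega}^h)\in V^h\times[V^h]^2$, writing $\widetilde\Gamma=\widetilde\Gamma^{m+1}$ and $\widetilde{\mathbf{n}}=\widetilde{\mathbf{n}}^{m+1}$, \begin{align*} \left(\tfrac{\frac32\mathbf{X}^{m+1}-2\mathbf{X}^m+\frac12\mathbf{X}^{m-1}}{\tau},\varphi^h\widetilde{\mathbf{n}}\right)^h_{\widetilde\Gamma}+\left(\partial_s\kappa^{m+1},\partial_s\varphi^h\right)_{\widetilde\Gamma}-\lambda^{m+1}\left(\kappa^{m+1},\varphi^h\right)^h_{\widetilde\Gamma}-\eta^{m+1}\left(1,\varphi^h\right)^h_{\widetilde\Gamma}&=0,\\ \left(\kappa^{m+1}\widetilde{\mathbf{n}},\boldsymbol{\omega}^h\right)^h_{\widetilde\Gamma}-\left(\partial_s\mathbf{X}^{m+1},\partial_s\boldsymbol{\omega}^h\right)_{\widetilde\Gamma}&=0,\\ \tfrac{\frac32L^{m+1}-2L^m+\frac12L^{m-1}}{\tau}+\left(\partial_s\kappa^{m+1},\partial_s\kappa^{m+1}\right)_{\widetilde\Gamma}&=0,\\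 \tfrac32A^{m+1}-2A^m+\tfrac12A^{m-1}&=0, \end{align*} where $L^m=L(\mathbf{X}^m)$, $A^m=A(\mathbf{X}^m)$, and $\widetilde\Gamma^{m+1}=\widetilde{\mathbf{X}}^{m+1}(\mathbb{I})$ is the predicted polygon, with normal $\widetilde{\mathbf{n}}^{m+1}$, obtained by one step of the SP-Euler scheme with time step $\tau$ starting from $\mathbf{X}^m$. Then for all $m\ge0$, $$L^{m+1}\le L^m\le\dots\le L^0,\qquad A^{m+1}=A^m=\dots=A^0 .$$
   Context: Let $\mathbb{I}=[0,1]=\bigcup_{j=1}^N I_j$, $N\ge3$, $I_j=[\rho_{j-1},\rho_j]$, $0=\rho_0<\dots<\rho_N=1$, and $$V^h=\{u\in C(\mathbb{I}):u|_{I_j}\text{ is linear for all }j=1,\dots,N,\ u(\rho_0)=u(\rho_N)\}.$$ For $\mathbf{X}\in[V^h]^2$ with polygon $\Gamma=\mathbf{X}(\mathbb{I})$ set $\mathbf{h}_j=\mathbf{X}(\rho_j)-\mathbf{X}(\rho_{j-1})$ (assumed nonzero for all $j$). On $\Gamma$ the piecewise constant normal and the tangential derivative are $\mathbf{n}|_{I_j}=-\mathbf{h}_j^\perp/|\mathbf{h}_j|$ and $\partial_sf|_{I_j}=\partial_\rho f/|\partial_\rho\mathbf{X}|$, where $(\cdot)^\perp$ is clockwise rotation by $\pi/2$, $(a,b)^\perp=(b,-a)$. The inner products are $(u,v)_\Gamma=\int_{\mathbb{I}}u\cdot v\,|\partial_\rho\mathbf{X}|\,\mathrm{d}\rho$ and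 the mass-lumped one $$(u,v)^h_\Gamma=\frac12\sum_{j=1}^N|\mathbf{h}_j|\left[(u\cdot v)(\rho_j^-)+(u\cdot v)(\rho_{j-1}^+)\right]$$ for piecewise continuous scalar/vector functions with one-sided limits $u(\rho_j^\pm)$. Within an inner product on a polygon, $\partial_s$ is the tangential derivative of that polygon. Perimeter and area are $L(\mathbf{X})=\int_{\mathbb{I}}|\partial_\rho\mathbf{X}|\,\mathrm{d}\rho$ and $A(\mathbf{X})=\frac12\int_{\Gamma}\mathbf{X}\cdot\mathbf{n}\,\mathrm{d}s=-\frac12\int_{\mathbb{I}}\mathbf{X}\cdot(\partial_\rho\mathbf{X})^\perp\,\mathrm{d}\rho$. One step of the SP-Euler scheme with time step $\sigma>0$ from $\mathbf{X}\in[V^h]^2$ (polygon $\Gamma$, normal $\mathbf{n}$) produces $\mathbf{Y}\in[V^h]^2$ if there are $k\in V^h$ and $\ell,e\in\mathbb{R}$ such that for all $\varphi^h\in V^h$, $\boldsymbol{\omega}^h\in[V^h]^2$: \begin{align*} &\left(\tfrac{\mathbf{Y}-\mathbf{X}}{\sigma},\varphi^h\mathbf{n}\right)^h_\Gamma+(\partial_sk,\partial_s\varphi^h)_\Gamma-\ell\,(k,\varphi^h)^h_\Gamma-e\,(1,\varphi^h)^h_\Gamma=0,\\ &(k\,\mathbf{n},\boldsymbol{\omega}^h)^h_\Gamma-(\partial_s\mathbf{Y},\partial_s\boldsymbol{\omega}^h)_\Gamma=0,\\ &\tfrac{L(\mathbf{Y})-L(\mathbf{X})}{\sigma}+(\partial_sk,\partial_sk)_\Gamma=0,\qquad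 A(\mathbf{Y})-A(\mathbf{X})=0. \end{align*} *)

theory Defs
  imports "HOL-Analysis.Analysis"
begin

text \<open>Functions on the unit interval are total functions on the reals; every notion below only
  looks at their restriction to \<open>{0..1}\<close>.\<close>

definition unit_partition :: "nat \<Rightarrow> (nat \<Rightarrow> real) \<Rightarrow> bool" where
  "unit_partition N \<rho> \<longleftrightarrow> N \<ge> 3 \<and> \<rho> 0 = 0 \<and> \<rho> N = 1 \<and> (\<forall>j\<in>{1..N}. \<rho> (j - 1) < \<rho> j)"

definition Vh :: "nat \<Rightarrow> (nat \<Rightarrow> real) \<Rightarrow> (real \<Rightarrow> real) set" where
  "Vh N \<rho> = {u. continuous_on {0..1} u
     \<and> (\<forall>j\<in>{1..N}. \<exists>a b. \<forall>r\<in>{\<rho> (j - 1)..\<rho> j}. u r = a + b * r)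
     \<and> u (\<rho> 0) = u (\<rho> N)}"

definition Vh2 :: "nat \<Rightarrow> (nat \<Rightarrow> real) \<Rightarrow> (real \<Rightarrow> real^2) set" where
  "Vh2 N \<rho> = {X. \<forall>i. (\<lambda>r. X r $ i) \<in> Vh N \<rho>}"

definition perp :: "real^2 \<Rightarrow> real^2" where
  "perp v = vector [v $ 2, - (v $ 1)]"

definition edge :: "(nat \<Rightarrow> real) \<Rightarrow> (real \<Rightarrow> real^2) \<Rightarrow> nat \<Rightarrow> real^2" where
  "edge \<rho> X j = X (\<rho> j) - X (\<rho> (j - 1))"

definition nondegenerate :: "nat \<Rightarrow> (nat \<Rightarrow> real) \<Rightarrow> (real \<Rightarrow> real^2) \<Rightarrow> bool" where
  "nondegenerate N \<rho> X \<longleftrightarrow> (\<forall>j\<in>{1..N}. edge \<rho> X j \<noteq> 0)"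

text \<open>Index of the subinterval containing \<open>r\<close>. A common endpoint of two subintervals is
  assigned to the left one; this choice is immaterial, since piecewise functions enter below only
  through integrals and one-sided limits.\<close>

definition seg :: "(nat \<Rightarrow> real) \<Rightarrow> real \<Rightarrow> nat" where
  "seg \<rho> r = (LEAST j. 1 \<le> j \<and> r \<le> \<rho> j)"

definition normal :: "(nat \<Rightarrow> real) \<Rightarrow> (real \<Rightarrow> real^2) \<Rightarrow> real \<Rightarrow> real^2" where
  "normal \<rho> X r = - (perp (edge \<rho> X (seg \<rho> r)) /\<^sub>R norm (edge \<rho> X (seg \<rho> r)))"

text \<open>The derivative with respect to the parameter. At the finitely many break points it may fail
  to exist, in which case its value is unspecified; it is only used under integrals.\<close>

definition Dpar :: "(real \<Rightarrow> 'a::real_normed_vector) \<Rightarrow> real \<Rightarrow> 'a" where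
  "Dpar f r = vector_derivative f (at r within {0..1})"

definition Ds :: "(real \<Rightarrow> real^2) \<Rightarrow> (real \<Rightarrow> 'a::real_normed_vector) \<Rightarrow> real \<Rightarrow> 'a" where
  "Ds X f r = Dpar f r /\<^sub>R norm (Dpar X r)"

text \<open>Both inner products cover scalar and vector functions: on the reals \<open>\<bullet>\<close> is multiplication.\<close>

definition ip :: "(real \<Rightarrow> real^2) \<Rightarrow> (real \<Rightarrow> 'a::real_inner) \<Rightarrow> (real \<Rightarrow> 'a) \<Rightarrow> real" where
  "ip X u v = integral {0..1} (\<lambda>r. (u r \<bullet> v r) * norm (Dpar X r))"

definition ip_lumped ::
  "nat \<Rightarrow> (nat \<Rightarrow> real) \<Rightarrow> (real \<Rightarrow> real^2) \<Rightarrow> (real \<Rightarrow> 'a::real_inner) \<Rightarrow> (real \<Rightarrow> 'a) \<Rightarrow> real" where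
  "ip_lumped N \<rho> X u v = 1 / 2 * (\<Sum>j=1..N. norm (edge \<rho> X j) *
     (Lim (at_left (\<rho> j)) (\<lambda>r. u r \<bullet> v r) + Lim (at_right (\<rho> (j - 1))) (\<lambda>r. u r \<bullet> v r)))"

definition perimeter :: "(real \<Rightarrow> real^2) \<Rightarrow> real" where
  "perimeter X = integral {0..1} (\<lambda>r. norm (Dpar X r))"

definition area :: "(real \<Rightarrow> real^2) \<Rightarrow> real" where
  "area X = - 1 / 2 * integral {0..1} (\<lambda>r. X r \<bullet> perp (Dpar X r))"

definition sp_euler_step ::
  "nat \<Rightarrow> (nat \<Rightarrow> real) \<Rightarrow> real \<Rightarrow> (real \<Rightarrow> real^2) \<Rightarrow> (real \<Rightarrow> real^2) \<Rightarrow> bool" where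
  "sp_euler_step N \<rho> \<sigma> X Y \<longleftrightarrow>
     X \<in> Vh2 N \<rho> \<and> Y \<in> Vh2 N \<rho> \<and>
     (\<exists>k\<in>Vh N \<rho>. \<exists>l e :: real.
        (\<forall>\<phi>\<in>Vh N \<rho>.
           ip_lumped N \<rho> X (\<lambda>r. (Y r - X r) /\<^sub>R \<sigma>) (\<lambda>r. \<phi> r *\<^sub>R normal \<rho> X r)
           + ip X (Ds X k) (Ds X \<phi>) - l * ip_lumped N \<rho> X k \<phi>
           - e * ip_lumped N \<rho> X (\<lambda>_. 1) \<phi> = 0) \<and>
        (\<forall>\<omega>\<in>Vh2 N \<rho>.
           ip_lumped N \<rho> X (\<lambda>r. k r *\<^sub>R normal \<rho> X r) \<omega> - ip X (Ds X Y) (Ds X \<omega>) = 0) \<and>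
        (perimeter Y - perimeter X) / \<sigma> + ip X (Ds X k) (Ds X k) = 0 \<and>
        area Y - area X = 0)"

text \<open>One SP-BDF2 step from \<open>X'\<close> (time level \<open>m - 1\<close>) and \<open>X\<close> (time level \<open>m\<close>) to \<open>(Y, k, l, e)\<close>
  (time level \<open>m + 1\<close>), on the predicted polygon \<open>Z\<close>.\<close>

definition sp_bdf2_step ::
  "nat \<Rightarrow> (nat \<Rightarrow> real) \<Rightarrow> real \<Rightarrow> (real \<Rightarrow> real^2) \<Rightarrow> (real \<Rightarrow> real^2) \<Rightarrow> (real \<Rightarrow> real^2) \<Rightarrow>
   (real \<Rightarrow> real^2) \<Rightarrow> (real \<Rightarrow> real) \<Rightarrow> real \<Rightarrow> real \<Rightarrow> bool" where
  "sp_bdf2_step N \<rho> \<tau> X' X Z Y k l e \<longleftrightarrow>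
     Y \<in> Vh2 N \<rho> \<and> k \<in> Vh N \<rho> \<and>
     (\<forall>\<phi>\<in>Vh N \<rho>.
        ip_lumped N \<rho> Z (\<lambda>r. ((3/2) *\<^sub>R Y r - 2 *\<^sub>R X r + (1/2) *\<^sub>R X' r) /\<^sub>R \<tau>)
          (\<lambda>r. \<phi> r *\<^sub>R normal \<rho> Z r)
        + ip Z (Ds Z k) (Ds Z \<phi>) - l * ip_lumped N \<rho> Z k \<phi>
        - e * ip_lumped N \<rho> Z (\<lambda>_. 1) \<phi> = 0) \<and>
     (\<forall>\<omega>\<in>Vh2 N \<rho>.
        ip_lumped N \<rho> Z (\<lambda>r. k r *\<^sub>R normal \<rho> Z r) \<omega> - ip Z (Ds Z Y) (Ds Z \<omega>) = 0) \<and>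
     (3/2 * perimeter Y - 2 * perimeter X + 1/2 * perimeter X') / \<tau> + ip Z (Ds Z k) (Ds Z k) = 0 \<and>
     3/2 * area Y - 2 * area X + 1/2 * area X' = 0"

end

theory Submission
  imports Defs
begin

text \<open>The dissipation term \<open>(\<partial>\<^sub>s k, \<partial>\<^sub>s k)\<close> is nonnegative, so the
  discrete energy law of a BDF2 step gives
  \<open>3 (L\<^sup>m\<^sup>+\<^sup>1 - L\<^sup>m) \<le> L\<^sup>m - L\<^sup>m\<^sup>-\<^sup>1\<close>, and in the same way
  \<open>3 (A\<^sup>m\<^sup>+\<^sup>1 - A\<^sup>m) = A\<^sup>m - A\<^sup>m\<^sup>-\<^sup>1\<close>: the sign of the increment is
  passed on from the initial Euler step by induction.\<close>

text \<open>The integrand is a squared norm times a norm, hence pointwise nonnegative. Since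
  \<open>u\<close> is arbitrary, integrability has to be treated by cases.\<close>

lemma ip_self_nonneg: "0 \<le> ip X u u"
proof (cases "(\<lambda>r. (u r \<bullet> u r) * norm (Dpar X r)) integrable_on {0..1}")
  case True
  then show ?thesis
    unfolding ip_def by (rule integral_nonneg) simp
next
  \<comment> \<open>\<open>integral\<close> takes the default value 0 on a non-integrable
    function.\<close>
  case False
  then show ?thesis
    unfolding ip_def by (simp add: not_integrable_integral)
qed

lemma sp_euler_step_area:
  "sp_euler_step N \<rho> \<sigma> X Y \<Longrightarrow> area Y = area X"
  unfolding sp_euler_step_def by force

lemma sp_euler_step_perimeter_le:
  assumes "sp_euler_step N \<rho> \<sigma> X Y" and "\<sigma> > 0"
  shows "perimeter Y \<le> perimeter X"
proof -
  obtain k :: "real \<Rightarrow> real"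
    where "(perimeter Y - perimeter X) / \<sigma> + ip X (Ds X k) (Ds X k) = 0"
    using assms(1) unfolding sp_euler_step_def by blast
  with ip_self_nonneg[of X "Ds X k"] have "(perimeter Y - perimeter X) / \<sigma> \<le> 0"
    by linarith
  with \<open>\<sigma> > 0\<close> show ?thesis
    by (simp add: divide_le_0_iff)
qed

text \<open>The BDF2 combination is half a difference of increments: 3/2 a - 2 b + 1/2 c = (3 (a -
  b) - (b - c)) / 2. The perimeter bound below rests on the same identity.\<close>

lemma sp_bdf2_step_area:
  assumes "sp_bdf2_step N \<rho> \<tau> X' X Z Y k l e"
  shows "3 * (area Y - area X) = area X - area X'"
  using assms unfolding sp_bdf2_step_def by force

lemma sp_bdf2_step_perimeter:
  assumes "sp_bdf2_step N \<rho> \<tau> X' X Z Y k l e" and "\<tau> > 0"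
  shows "3 * (perimeter Y - perimeter X) \<le> perimeter X - perimeter X'"
proof -
  have "(3/2 * perimeter Y - 2 * perimeter X + 1/2 * perimeter X') / \<tau> + ip Z (Ds Z k) (Ds Z k) = 0"
    using assms(1) unfolding sp_bdf2_step_def by blast
  with ip_self_nonneg[of Z "Ds Z k"]
  have "(3/2 * perimeter Y - 2 * perimeter X + 1/2 * perimeter X') / \<tau> \<le> 0"
    by linarith
  with \<open>\<tau> > 0\<close> have "3/2 * perimeter Y - 2 * perimeter X + 1/2 * perimeter X' \<le> 0"
    by (simp add: divide_le_0_iff)
  then show ?thesis
    by (simp add: field_simps)
qed

theorem theorem3p3:
  fixes N :: nat and \<rho> :: "nat \<Rightarrow> real" and \<tau> :: real
    and X Xt :: "nat \<Rightarrow> real \<Rightarrow> real^2"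
    and \<kappa> :: "nat \<Rightarrow> real \<Rightarrow> real" and lam \<eta> :: "nat \<Rightarrow> real"
  assumes "unit_partition N \<rho>"
    and "\<tau> > 0"
    and "X 0 \<in> Vh2 N \<rho>"
    and "\<And>m. nondegenerate N \<rho> (X m)"
    and "sp_euler_step N \<rho> \<tau> (X 0) (X 1)"
    and "\<And>m. m \<ge> 1 \<Longrightarrow> sp_euler_step N \<rho> \<tau> (X m) (Xt (m + 1))"
    and "\<And>m. m \<ge> 1 \<Longrightarrow> nondegenerate N \<rho> (Xt (m + 1))"
    and "\<And>m. m \<ge> 1 \<Longrightarrow> sp_bdf2_step N \<rho> \<tau> (X (m - 1)) (X m) (Xt (m + 1))
           (X (m + 1)) (\<kappa> (m + 1)) (lam (m + 1)) (\<eta> (m + 1))"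
  shows "\<forall>m. (\<forall>i\<le>m. perimeter (X (i + 1)) \<le> perimeter (X i)) \<and>
             (\<forall>i\<le>m. area (X (i + 1)) = area (X i) \<and> area (X i) = area (X 0))"
proof -
  \<comment> \<open>Written in increments, the two-step recursion only looks back to the previous
    increment, so ordinary induction suffices.\<close>
  have step: "perimeter (X (i + 1)) \<le> perimeter (X i) \<and> area (X (i + 1)) = area (X i)" for i
  proof (induction i)
    case 0
    show ?case
      using sp_euler_step_perimeter_le[OF assms(5,2)] sp_euler_step_area[OF assms(5)] by simp
  next
    case (Suc i)
    \<comment> \<open>Taking \<open>m = Suc i\<close> secures \<open>m \<ge> 1\<close> and turns the
      truncated \<open>m - 1\<close> into \<open>i\<close>, the level of the induction
      hypothesis.\<close>
    from assms(8)[of "Suc i"]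
    have bdf2: "sp_bdf2_step N \<rho> \<tau> (X i) (X (i + 1)) (Xt (i + 2)) (X (i + 2))
        (\<kappa> (i + 2)) (lam (i + 2)) (\<eta> (i + 2))"
      by simp
    show ?case
      using Suc.IH sp_bdf2_step_perimeter[OF bdf2 assms(2)] sp_bdf2_step_area[OF bdf2] by simp
  qed
  have "area (X i) = area (X 0)" for i
    using step by (induction i) simp_all
  with step show ?thesis
    by blast
qed

end
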